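(* Let $q(x_{1:T}\mid x_0)=\prod_{t=1}^Tq(x_t\mid x_{t-1})$ be the forward diffusion process and $p^\theta(x_{0:T})=p(x_T)\prod_{t=1}^Tp^\theta(x_{t-1}\mid x_t)$ the parameterised reverse process. Then $$\mathbb E_{q(x_{1:T}\mid x_0)}\bigl[\log p^\theta(x_0\mid x_{1:T})\bigr]=\mathbb E_{q(x_1\mid x_0)}\bigl[\log p^\theta(x_0\mid x_1)\bigr],$$ and $$D_{\mathrm{KL}}\bigl(q(x_{1:T}\mid x_0)\,\|\,p^\theta(x_{1:T})\bigr)=D_{\mathrm{KL}}\bigl(q(x_T\mid x_0)\,\|\,p(x_T)\bigr)+\sum_{t=2}^T\mathbb E_{q(x_t\mid x_0)}\Bigl[D_{\mathrm{KL}}\bigl(q(x_{t-1}\mid x_t,x_0)\,\|\,p^\theta(x_{t-1}\mid x_t)\bigr)\Bigr].$$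
   Context: The state space is $\mathcal X^d$ with $\mathcal X=\mathbb R$ (densities with respect to Lebesgue measure) or $\mathcal X=\{1,\dots,K\}$ (probability mass functions). $p^\theta(x_{1:T})=\int p^\theta(x_{0:T})dx_0$ and $p^\theta(x_0\mid x_{1:T})$ are the marginal and conditional under the reverse process; $q(x_t\mid x_0)$ and $q(x_{t-1}\mid x_t,x_0)$ are the marginals and conditionals under the forward process started from the fixed point $x_0$. $p(x_T)$ is a fixed prior. All logarithms and expectations are assumed well defined. *)

theory Defs
  imports "HOL-Probability.Probability"
begin

text \<open>
  \<open>M\<close> is the reference measure on the state space (Lebesgue or counting measure), and all
  densities are taken with respect to \<open>M\<close> or its finite powers.  A trajectory is a function
  \<open>x\<close> on time indices, so \<open>x t\<close> is the state at time \<open>t\<close>.  The forward kernels are written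
  \<open>q t x y\<close> for \<open>q(x\<^sub>t = y | x\<^sub>t\<^sub>-\<^sub>1 = x)\<close>; the reverse kernels, for a fixed parameter, are
  written \<open>p t x y\<close> for \<open>p(x\<^sub>t\<^sub>-\<^sub>1 = y | x\<^sub>t = x)\<close>.
\<close>

definition prob_density :: "'a measure \<Rightarrow> ('a \<Rightarrow> real) \<Rightarrow> bool" where
  "prob_density M f \<longleftrightarrow>
     f \<in> borel_measurable M \<and> (\<forall>x\<in>space M. 0 \<le> f x) \<and> (\<integral>\<^sup>+ x. ennreal (f x) \<partial>M) = 1"

definition transition_density :: "'a measure \<Rightarrow> ('a \<Rightarrow> 'a \<Rightarrow> real) \<Rightarrow> bool" where
  "transition_density M k \<longleftrightarrow>
     case_prod k \<in> borel_measurable (M \<Otimes>\<^sub>M M) \<and> (\<forall>x\<in>space M. prob_density M (k x))"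

definition diffusion_model ::
  "'a measure \<Rightarrow> nat \<Rightarrow> (nat \<Rightarrow> 'a \<Rightarrow> 'a \<Rightarrow> real) \<Rightarrow> (nat \<Rightarrow> 'a \<Rightarrow> 'a \<Rightarrow> real) \<Rightarrow> ('a \<Rightarrow> real) \<Rightarrow> bool"
  where
  "diffusion_model M T q p prior \<longleftrightarrow>
     (\<forall>t\<in>{1..T}. transition_density M (q t)) \<and>
     (\<forall>t\<in>{1..T}. transition_density M (p t)) \<and>
     prob_density M prior"

abbreviation path_measure :: "'a measure \<Rightarrow> nat set \<Rightarrow> (nat \<Rightarrow> 'a) measure" where
  "path_measure M I \<equiv> PiM I (\<lambda>_. M)"


subsection \<open>Forward process started at \<open>x0\<close>\<close>

definition fwd_joint ::
  "(nat \<Rightarrow> 'a \<Rightarrow> 'a \<Rightarrow> real) \<Rightarrow> nat \<Rightarrow> 'a \<Rightarrow> (nat \<Rightarrow> 'a) \<Rightarrow> real" where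
  "fwd_joint q T x0 x = (\<Prod>t=1..T. q t ((x(0 := x0)) (t - 1)) (x t))"

definition fwd_law ::
  "'a measure \<Rightarrow> (nat \<Rightarrow> 'a \<Rightarrow> 'a \<Rightarrow> real) \<Rightarrow> nat \<Rightarrow> 'a \<Rightarrow> (nat \<Rightarrow> 'a) measure" where
  "fwd_law M q T x0 = density (path_measure M {1..T}) (\<lambda>x. ennreal (fwd_joint q T x0 x))"

text \<open>
  The marginal densities of \<open>x\<^sub>t\<close> and of \<open>(x\<^sub>t\<^sub>-\<^sub>1, x\<^sub>t)\<close> given \<open>x0\<close> integrate out all other
  coordinates of the joint density.  The integrals could diverge at a null set of arguments,
  where they take the value 0; this does not affect the measures they define.
\<close>

definition fwd_marginal ::
  "'a measure \<Rightarrow> (nat \<Rightarrow> 'a \<Rightarrow> 'a \<Rightarrow> real) \<Rightarrow> nat \<Rightarrow> 'a \<Rightarrow> nat \<Rightarrow> 'a \<Rightarrow> real" where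
  "fwd_marginal M q T x0 t y =
     (\<integral>x. fwd_joint q T x0 (x(t := y)) \<partial>path_measure M ({1..T} - {t}))"

definition fwd_pair_marginal ::
  "'a measure \<Rightarrow> (nat \<Rightarrow> 'a \<Rightarrow> 'a \<Rightarrow> real) \<Rightarrow> nat \<Rightarrow> 'a \<Rightarrow> nat \<Rightarrow> 'a \<Rightarrow> 'a \<Rightarrow> real" where
  "fwd_pair_marginal M q T x0 t y z =
     (\<integral>x. fwd_joint q T x0 (x(t - 1 := y, t := z)) \<partial>path_measure M ({1..T} - {t - 1, t}))"

definition fwd_marginal_law ::
  "'a measure \<Rightarrow> (nat \<Rightarrow> 'a \<Rightarrow> 'a \<Rightarrow> real) \<Rightarrow> nat \<Rightarrow> 'a \<Rightarrow> nat \<Rightarrow> 'a measure" where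
  "fwd_marginal_law M q T x0 t = density M (\<lambda>y. ennreal (fwd_marginal M q T x0 t y))"

text \<open>\<open>fwd_posterior M q T x0 t z y\<close> is \<open>q(x\<^sub>t\<^sub>-\<^sub>1 = y | x\<^sub>t = z, x0)\<close>, meant for \<open>2 \<le> t \<le> T\<close>.\<close>

definition fwd_posterior ::
  "'a measure \<Rightarrow> (nat \<Rightarrow> 'a \<Rightarrow> 'a \<Rightarrow> real) \<Rightarrow> nat \<Rightarrow> 'a \<Rightarrow> nat \<Rightarrow> 'a \<Rightarrow> 'a \<Rightarrow> real" where
  "fwd_posterior M q T x0 t z y = fwd_pair_marginal M q T x0 t y z / fwd_marginal M q T x0 t z"


subsection \<open>Reverse process\<close>

definition rev_joint ::
  "(nat \<Rightarrow> 'a \<Rightarrow> 'a \<Rightarrow> real) \<Rightarrow> ('a \<Rightarrow> real) \<Rightarrow> nat \<Rightarrow> (nat \<Rightarrow> 'a) \<Rightarrow> real" where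
  "rev_joint p prior T x = prior (x T) * (\<Prod>t=1..T. p t (x t) (x (t - 1)))"

definition rev_latent ::
  "'a measure \<Rightarrow> (nat \<Rightarrow> 'a \<Rightarrow> 'a \<Rightarrow> real) \<Rightarrow> ('a \<Rightarrow> real) \<Rightarrow> nat \<Rightarrow> (nat \<Rightarrow> 'a) \<Rightarrow> real" where
  "rev_latent M p prior T x = (\<integral>y. rev_joint p prior T (x(0 := y)) \<partial>M)"

definition rev_latent_law ::
  "'a measure \<Rightarrow> (nat \<Rightarrow> 'a \<Rightarrow> 'a \<Rightarrow> real) \<Rightarrow> ('a \<Rightarrow> real) \<Rightarrow> nat \<Rightarrow> (nat \<Rightarrow> 'a) measure" where
  "rev_latent_law M p prior T =
     density (path_measure M {1..T}) (\<lambda>x. ennreal (rev_latent M p prior T x))"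

text \<open>The conditional density of \<open>x\<^sub>0\<close> given the latent trajectory, evaluated at \<open>x0\<close>.\<close>

definition rev_cond ::
  "'a measure \<Rightarrow> (nat \<Rightarrow> 'a \<Rightarrow> 'a \<Rightarrow> real) \<Rightarrow> ('a \<Rightarrow> real) \<Rightarrow> nat \<Rightarrow> 'a \<Rightarrow> (nat \<Rightarrow> 'a) \<Rightarrow> real" where
  "rev_cond M p prior T x0 x = rev_joint p prior T (x(0 := x0)) / rev_latent M p prior T x"


subsection \<open>Kullback--Leibler divergence and well-definedness\<close>

text \<open>The library's \<^const>\<open>KL_divergence\<close> takes the reference distribution first.\<close>

abbreviation KL :: "'a measure \<Rightarrow> 'a measure \<Rightarrow> real" where
  "KL Q P \<equiv> KL_divergence (exp 1) P Q"

text \<open>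
  The expectation of \<open>ln f\<close> under \<open>Q\<close> is well defined.  When \<open>f\<close> is a quotient, strict positivity
  also excludes a vanishing denominator, since \<open>a / 0 = 0\<close>.
\<close>

definition log_expectation_defined :: "'a measure \<Rightarrow> ('a \<Rightarrow> real) \<Rightarrow> bool" where
  "log_expectation_defined Q f \<longleftrightarrow> (AE x in Q. 0 < f x) \<and> integrable Q (\<lambda>x. ln (f x))"

end

theory Submission
  imports Defs
begin

text \<open>
  The factor \<open>prior (x T) * (\<Prod>t\<ge>2. p t (x t) (x (t - 1)))\<close> is common to the joint reverse density and
  to its latent marginal, which leaves \<open>p 1 (x 1) x0\<close> as the conditional density.  By the Markov
  property the density of \<open>(x\<^sub>t\<^sub>-\<^sub>1, x\<^sub>t)\<close> is the marginal density at \<open>t - 1\<close> times \<open>q t\<close>, so the forward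
  joint density is the marginal at \<open>T\<close> times the backward posteriors, and the logarithm of the ratio
  of the path densities is a sum of one prior term and \<open>T - 1\<close> step terms.

  Only the integrability of this sum is assumed.  Since \<open>ln (g / f) \<le> g / f\<close>, the negative part of
  \<open>ln (f / g)\<close> has expectation at most \<open>\<integral> g\<close> under the density \<open>f\<close>.  Hence every summand has an
  integrable negative part, and then every summand is integrable.
\<close>

section \<open>Forward densities: integrating out states and fixing others\<close>

lemma measurable_override_on:
  assumes "J \<subseteq> I" "w \<in> J \<rightarrow> space M"
  shows "(\<lambda>x. override_on x w J) \<in> measurable (path_measure M (I - J)) (path_measure M I)"
  unfolding override_on_def
proof (rule measurable_PiM_single')
  fix i assume "i \<in> I"
  then show "(\<lambda>x. if i \<in> J then w i else x i) \<in> measurable (path_measure M (I - J)) M"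
    using assms by (cases "i \<in> J") (auto intro!: measurable_const)
next
  show "(\<lambda>x i. if i \<in> J then w i else x i)
      \<in> space (path_measure M (I - J)) \<rightarrow> (\<Pi>\<^sub>E i\<in>I. space M)"
    using assms by (auto simp: space_PiM PiE_iff extensional_def)
qed

lemma fwd_joint_cong:
  assumes "\<And>t. t \<in> {1..n} \<Longrightarrow> x t = y t"
  shows "fwd_joint q n x0 x = fwd_joint q n x0 y"
  unfolding fwd_joint_def
proof (rule prod.cong)
  fix t assume t: "t \<in> {1..n}"
  then have "t - 1 = 0 \<or> t - 1 \<in> {1..n}"
    by auto
  then have "(x(0 := x0)) (t - 1) = (y(0 := x0)) (t - 1)"
    using assms by (metis fun_upd_apply)
  then show "q t ((x(0 := x0)) (t - 1)) (x t) = q t ((y(0 := x0)) (t - 1)) (y t)"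
    using assms[OF t] by simp
qed simp

lemma fwd_joint_Suc:
  "fwd_joint q (Suc n) x0 x = fwd_joint q n x0 x * q (Suc n) ((x(0 := x0)) n) (x (Suc n))"
  by (simp add: fwd_joint_def)

locale forward_process = sigma_finite_measure M for M :: "'a measure" +
  fixes q :: "nat \<Rightarrow> 'a \<Rightarrow> 'a \<Rightarrow> real" and T :: nat and x0 :: 'a
  assumes q: "\<And>t. t \<in> {1..T} \<Longrightarrow> transition_density M (q t)"
    and x0: "x0 \<in> space M"
begin

sublocale product_sigma_finite "\<lambda>_::nat. M"
  by unfold_locales

sublocale pair: pair_sigma_finite M M
  by unfold_locales

lemma measurable_q: "t \<in> {1..T} \<Longrightarrow> case_prod (q t) \<in> borel_measurable (M \<Otimes>\<^sub>M M)"
  using q by (auto simp: transition_density_def)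

lemma q_nonneg: "t \<in> {1..T} \<Longrightarrow> a \<in> space M \<Longrightarrow> b \<in> space M \<Longrightarrow> 0 \<le> q t a b"
  using q by (auto simp: transition_density_def prob_density_def)

lemma nn_integral_q: "t \<in> {1..T} \<Longrightarrow> a \<in> space M \<Longrightarrow> (\<integral>\<^sup>+b. ennreal (q t a b) \<partial>M) = 1"
  using q by (auto simp: transition_density_def prob_density_def)

lemma measurable_q_comp:
  assumes "t \<in> {1..T}" "f \<in> measurable N M" "g \<in> measurable N M"
  shows "(\<lambda>x. q t (f x) (g x)) \<in> borel_measurable N"
  using measurable_compose[OF measurable_Pair[OF assms(2,3)] measurable_q[OF assms(1)]] by simp

text \<open>The first kernel reads its predecessor at time 0, where the state is the constant
  \<open>x0\<close>; hence the separate case \<open>t = 0\<close>.\<close>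

lemma fwd_state_measurable:
  assumes "t \<in> I \<or> t = 0"
  shows "(\<lambda>x. (x(0 := x0)) t) \<in> measurable (path_measure M I) M"
  using assms x0 by (cases "t = 0") auto

lemma fwd_state_space:
  assumes "t \<in> I \<or> t = 0" "x \<in> space (path_measure M I)"
  shows "(x(0 := x0)) t \<in> space M"
  using measurable_space[OF fwd_state_measurable[OF assms(1)] assms(2)] .

lemma measurable_fwd_joint:
  assumes "{1..n} \<subseteq> I" "n \<le> T"
  shows "fwd_joint q n x0 \<in> borel_measurable (path_measure M I)"
proof -
  have "(\<lambda>x. \<Prod>t=1..n. q t ((x(0 := x0)) (t - 1)) (x t)) \<in> borel_measurable (path_measure M I)"
  proof (rule borel_measurable_prod)
    fix t assume t: "t \<in> {1..n}"
    then have "t - 1 \<in> {1..n} \<or> t - 1 = 0"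
      by auto
    then have "t - 1 \<in> I \<or> t - 1 = 0" "t \<in> I"
      using t assms by auto
    with t assms show "(\<lambda>x. q t ((x(0 := x0)) (t - 1)) (x t)) \<in> borel_measurable (path_measure M I)"
      by (intro measurable_q_comp fwd_state_measurable) auto
  qed
  then show ?thesis
    by (simp add: fwd_joint_def[abs_def])
qed

lemma fwd_joint_nonneg:
  assumes "{1..n} \<subseteq> I" "n \<le> T" "x \<in> space (path_measure M I)"
  shows "0 \<le> fwd_joint q n x0 x"
  unfolding fwd_joint_def
proof (rule prod_nonneg)
  fix t assume t: "t \<in> {1..n}"
  then have "t - 1 \<in> {1..n} \<or> t - 1 = 0"
    by auto
  then have I: "t - 1 \<in> I \<or> t - 1 = 0" "t \<in> I"
    using t assms by auto
  have "x t \<in> space M"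
    using I assms(3) by (auto simp: space_PiM)
  then show "0 \<le> q t ((x(0 := x0)) (t - 1)) (x t)"
    using t assms fwd_state_space[OF I(1) assms(3)] by (intro q_nonneg) auto
qed

text \<open>Each kernel after time \<open>m\<close> has total mass 1, and these are integrated out
  one at a time, latest first. The set \<open>J\<close> of fixed states serves three purposes: empty
  for the total mass, \<open>{t}\<close> for marginals, \<open>{t - 1, t}\<close> for pairs. With
  nonnegative integrals no integrability has to be checked.\<close>

lemma nn_integral_fwd_joint_drop_future:
  assumes "J \<subseteq> {1..m}" "m \<le> n" "n \<le> T" and w: "w \<in> J \<rightarrow> space M"
  shows "(\<integral>\<^sup>+x. ennreal (fwd_joint q n x0 (override_on x w J)) \<partial>path_measure M ({1..n} - J)) =
    (\<integral>\<^sup>+x. ennreal (fwd_joint q m x0 (override_on x w J)) \<partial>path_measure M ({1..m} - J))"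
  using assms(2,3)
proof (induction n rule: dec_induct)
  case base
  show ?case by simp
next
  case (step n)
  have J: "J \<subseteq> {1..n}"
    using assms(1) step.hyps by auto
  have I: "{1..Suc n} - J = insert (Suc n) ({1..n} - J)"
    using J by auto
  have "(\<lambda>x. ennreal (fwd_joint q (Suc n) x0 (override_on x w J)))
      \<in> borel_measurable (path_measure M ({1..Suc n} - J))"
    using measurable_compose[OF measurable_override_on measurable_fwd_joint, of J "{1..Suc n}" w]
      J w step.prems by fastforce
  \<comment> \<open>The state at \<open>Suc n\<close> is integrated innermost, where all factors of
    earlier times are constants.\<close>
  then have "(\<integral>\<^sup>+x. ennreal (fwd_joint q (Suc n) x0 (override_on x w J))
        \<partial>path_measure M ({1..Suc n} - J)) =
      (\<integral>\<^sup>+x. \<integral>\<^sup>+y. ennreal (fwd_joint q (Suc n) x0 (override_on (x(Suc n := y)) w J)) \<partial>M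
        \<partial>path_measure M ({1..n} - J))"
    unfolding I by (intro product_nn_integral_insert) auto
  also have "\<dots> = (\<integral>\<^sup>+x. ennreal (fwd_joint q n x0 (override_on x w J))
      \<partial>path_measure M ({1..n} - J))"
  proof (rule nn_integral_cong)
    fix x assume x: "x \<in> space (path_measure M ({1..n} - J))"
    let ?x = "override_on x w J"
    have sp: "?x \<in> space (path_measure M {1..n})"
      using measurable_space[OF measurable_override_on[OF J w] x] .
    have F0: "0 \<le> fwd_joint q n x0 ?x"
      using fwd_joint_nonneg[OF subset_refl _ sp] step.prems by simp
    \<comment> \<open>For \<open>n = 0\<close> the source state of the last kernel is
      \<open>x0\<close>, otherwise the state at time \<open>n\<close>.\<close>
    have s: "(?x(0 := x0)) n \<in> space M"
      by (rule fwd_state_space[OF _ sp]) auto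
    have "fwd_joint q (Suc n) x0 (override_on (x(Suc n := y)) w J) =
        fwd_joint q n x0 ?x * q (Suc n) ((?x(0 := x0)) n) y" for y
    proof -
      have "fwd_joint q n x0 (override_on (x(Suc n := y)) w J) = fwd_joint q n x0 ?x"
        by (rule fwd_joint_cong) (auto simp: override_on_def)
      moreover have "override_on (x(Suc n := y)) w J (Suc n) = y"
        using J by (auto simp: override_on_def)
      ultimately show ?thesis
        by (simp add: fwd_joint_Suc override_on_def)
    qed
    then have "(\<integral>\<^sup>+y. ennreal (fwd_joint q (Suc n) x0 (override_on (x(Suc n := y)) w J)) \<partial>M) =
        (\<integral>\<^sup>+y. ennreal (fwd_joint q n x0 ?x) * ennreal (q (Suc n) ((?x(0 := x0)) n) y) \<partial>M)"
      using F0 by (simp add: ennreal_mult')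
    also have "\<dots> = ennreal (fwd_joint q n x0 ?x)
        * (\<integral>\<^sup>+y. ennreal (q (Suc n) ((?x(0 := x0)) n) y) \<partial>M)"
      using s step.prems
      by (intro nn_integral_cmult measurable_compose[OF measurable_q_comp measurable_ennreal]) auto
    also have "\<dots> = ennreal (fwd_joint q n x0 ?x)"
      using s step.prems by (simp add: nn_integral_q)
    finally show "(\<integral>\<^sup>+y. ennreal (fwd_joint q (Suc n) x0 (override_on (x(Suc n := y)) w J)) \<partial>M) =
        ennreal (fwd_joint q n x0 ?x)" .
  qed
  finally show ?case
    using step by simp
qed

text \<open>The case \<open>m = 0\<close> without fixed states: all kernels integrate out, which
  leaves the empty product on a one-point space.\<close>

lemma nn_integral_fwd_joint:
  "(\<integral>\<^sup>+x. ennreal (fwd_joint q T x0 x) \<partial>path_measure M {1..T}) = 1"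
  using nn_integral_fwd_joint_drop_future[of "{}" 0 T "\<lambda>_. undefined"]
  by (simp add: fwd_joint_def PiM_empty nn_integral_count_space_finite)

text \<open>An extended-valued marginal density built from the times up to \<open>t\<close> only,
  hence independent of the horizon. It keeps the value infinity where the real-valued
  \<open>fwd_marginal\<close> is 0 by convention.\<close>

definition nn_marginal :: "nat \<Rightarrow> 'a \<Rightarrow> ennreal" where
  "nn_marginal t y =
    (\<integral>\<^sup>+x. ennreal (fwd_joint q t x0 (x(t := y))) \<partial>path_measure M ({1..t} - {t}))"

lemma nn_integral_fwd_joint_fix:
  assumes "t \<in> {1..T}" "y \<in> space M"
  shows "(\<integral>\<^sup>+x. ennreal (fwd_joint q T x0 (x(t := y))) \<partial>path_measure M ({1..T} - {t})) =
    nn_marginal t y"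
proof -
  have "override_on x (\<lambda>_. y) {t} = x(t := y)" for x
    by (auto simp: override_on_def)
  then show ?thesis
    using nn_integral_fwd_joint_drop_future[of "{t}" t T "\<lambda>_. y"] assms
    by (simp add: nn_marginal_def)
qed

lemma measurable_fwd_joint_upd:
  assumes "t \<in> {1..n}" "n \<le> T" "y \<in> space M"
  shows "(\<lambda>x. fwd_joint q n x0 (x(t := y))) \<in> borel_measurable (path_measure M ({1..n} - {t}))"
proof -
  have "(\<lambda>x. x(t := y)) \<in> measurable (path_measure M ({1..n} - {t})) (path_measure M {1..n})"
    using assms by (intro measurable_fun_upd[where J = "{1..n} - {t}"]) auto
  from measurable_compose[OF this measurable_fwd_joint[OF subset_refl assms(2)]] show ?thesis .
qed

text \<open>The Markov property: after the future of \<open>t\<close> has dropped out,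
  \<open>z\<close> occurs only in the kernel at \<open>t\<close>, which depends on the past through
  \<open>y\<close> alone.\<close>

lemma nn_integral_fwd_joint_fix2:
  assumes "t \<in> {2..T}" "y \<in> space M" "z \<in> space M"
  shows "(\<integral>\<^sup>+x. ennreal (fwd_joint q T x0 (x(t - 1 := y, t := z)))
      \<partial>path_measure M ({1..T} - {t - 1, t})) = nn_marginal (t - 1) y * ennreal (q t y z)"
proof -
  let ?w = "(\<lambda>_. y)(t := z)"
  have [simp]: "t - Suc 0 \<noteq> t"
    using assms by auto
  have "override_on x ?w {t - 1, t} = x(t - 1 := y, t := z)" for x
    using assms(1) by (auto simp: override_on_def fun_eq_iff)
  then have "(\<integral>\<^sup>+x. ennreal (fwd_joint q T x0 (x(t - 1 := y, t := z)))
      \<partial>path_measure M ({1..T} - {t - 1, t})) =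
    (\<integral>\<^sup>+x. ennreal (fwd_joint q t x0 (x(t - 1 := y, t := z)))
      \<partial>path_measure M ({1..t} - {t - 1, t}))"
    using nn_integral_fwd_joint_drop_future[of "{t - 1, t}" t T ?w] assms by auto
  \<comment> \<open>With both states fixed, exactly the states before \<open>t - 1\<close> are left,
    over which \<open>nn_marginal (t - 1)\<close> integrates.\<close>
  also have "{1..t} - {t - 1, t} = {1..t - 1} - {t - 1}"
    by auto
  also have "(\<integral>\<^sup>+x. ennreal (fwd_joint q t x0 (x(t - 1 := y, t := z)))
        \<partial>path_measure M ({1..t - 1} - {t - 1})) =
      (\<integral>\<^sup>+x. ennreal (fwd_joint q (t - 1) x0 (x(t - 1 := y))) * ennreal (q t y z)
        \<partial>path_measure M ({1..t - 1} - {t - 1}))"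
  proof (rule nn_integral_cong)
    fix x
    have "fwd_joint q t x0 (x(t - 1 := y, t := z)) =
        fwd_joint q (t - 1) x0 (x(t - 1 := y, t := z)) * q t y z"
      using fwd_joint_Suc[of q "t - 1" x0 "x(t - 1 := y, t := z)"] assms by simp
    also have "fwd_joint q (t - 1) x0 (x(t - 1 := y, t := z)) = fwd_joint q (t - 1) x0 (x(t - 1 := y))"
      by (rule fwd_joint_cong) auto
    finally have "fwd_joint q t x0 (x(t - 1 := y, t := z)) =
        fwd_joint q (t - 1) x0 (x(t - 1 := y)) * q t y z" .
    then show "ennreal (fwd_joint q t x0 (x(t - 1 := y, t := z))) =
        ennreal (fwd_joint q (t - 1) x0 (x(t - 1 := y))) * ennreal (q t y z)"
      using ennreal_mult''[OF q_nonneg[of t y z]] assms by (simp only:) auto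
  qed
  also have "\<dots> = nn_marginal (t - 1) y * ennreal (q t y z)"
    unfolding nn_marginal_def
    using measurable_fwd_joint_upd[of "t - 1" "t - 1" y] assms
    by (intro nn_integral_multc measurable_compose[OF _ measurable_ennreal]) auto
  finally show ?thesis .
qed

lemma fwd_joint_upd_nonneg:
  assumes "t \<in> {1..T}" "y \<in> space M" "x \<in> space (path_measure M ({1..T} - {t}))"
  shows "0 \<le> fwd_joint q T x0 (x(t := y))"
proof (rule fwd_joint_nonneg[OF subset_refl order_refl])
  show "x(t := y) \<in> space (path_measure M {1..T})"
    using assms by (auto simp: space_PiM PiE_iff extensional_def)
qed

text \<open>For a nonnegative integrand the Bochner integral is \<open>enn2real\<close> of the
  nonnegative integral, also in the divergent case, where both are 0.\<close>

lemma fwd_marginal_eq: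
  assumes "t \<in> {1..T}" "y \<in> space M"
  shows "fwd_marginal M q T x0 t y = enn2real (nn_marginal t y)"
  unfolding fwd_marginal_def nn_integral_fwd_joint_fix[OF assms, symmetric]
  using assms
  by (intro integral_eq_nn_integral measurable_fwd_joint_upd AE_I2 fwd_joint_upd_nonneg) auto

text \<open>As \<open>enn2real\<close> is multiplicative, the factorization holds at every pair of
  states; where the marginal at \<open>t - 1\<close> diverges, both sides are 0.\<close>

lemma fwd_pair_marginal_eq:
  assumes "t \<in> {2..T}" "y \<in> space M" "z \<in> space M"
  shows "fwd_pair_marginal M q T x0 t y z = fwd_marginal M q T x0 (t - 1) y * q t y z"
proof -
  let ?N = "path_measure M ({1..T} - {t - 1, t})"
  have m: "(\<lambda>x. x(t - 1 := y, t := z)) \<in> measurable ?N (path_measure M {1..T})"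
    using assms by (intro measurable_fun_upd[where J = "{1..T} - {t}"]
        measurable_fun_upd[where J = "{1..T} - {t - 1, t}"]) auto
  have "fwd_pair_marginal M q T x0 t y z =
      enn2real (\<integral>\<^sup>+x. ennreal (fwd_joint q T x0 (x(t - 1 := y, t := z))) \<partial>?N)"
    unfolding fwd_pair_marginal_def
  proof (rule integral_eq_nn_integral)
    show "(\<lambda>x. fwd_joint q T x0 (x(t - 1 := y, t := z))) \<in> borel_measurable ?N"
      using measurable_compose[OF m measurable_fwd_joint[OF subset_refl order_refl]] .
    show "AE x in ?N. 0 \<le> fwd_joint q T x0 (x(t - 1 := y, t := z))"
      using measurable_space[OF m] by (intro AE_I2 fwd_joint_nonneg[OF subset_refl order_refl])
  qed
  also have "\<dots> = enn2real (nn_marginal (t - 1) y) * q t y z"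
    using nn_integral_fwd_joint_fix2[OF assms] assms by (simp add: enn2real_mult q_nonneg)
  also have "enn2real (nn_marginal (t - 1) y) = fwd_marginal M q T x0 (t - 1) y"
    using assms by (intro fwd_marginal_eq[symmetric]) auto
  finally show ?thesis .
qed

lemma measurable_nn_marginal:
  assumes "t \<in> {1..T}"
  shows "nn_marginal t \<in> borel_measurable M"
proof -
  interpret P: sigma_finite_measure "path_measure M ({1..t} - {t})"
    by (rule sigma_finite) simp
  have "(\<lambda>p. (snd p)(t := fst p))
      \<in> measurable (M \<Otimes>\<^sub>M path_measure M ({1..t} - {t})) (path_measure M {1..t})"
    using assms by (intro measurable_fun_upd[where J = "{1..t} - {t}"]) auto
  from measurable_compose[OF this measurable_fwd_joint[OF subset_refl]] assms
  have m: "(\<lambda>p. fwd_joint q t x0 ((snd p)(t := fst p)))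
      \<in> borel_measurable (M \<Otimes>\<^sub>M path_measure M ({1..t} - {t}))"
    by simp
  show ?thesis
    unfolding nn_marginal_def[abs_def]
    unfolding split_beta' by (rule P.borel_measurable_nn_integral)
      (use measurable_compose[OF m measurable_ennreal] in \<open>simp add: split_beta'\<close>)
qed

lemma measurable_fwd_marginal:
  assumes "t \<in> {1..T}"
  shows "fwd_marginal M q T x0 t \<in> borel_measurable M"
proof -
  have "fwd_marginal M q T x0 t \<in> borel_measurable M \<longleftrightarrow>
      (\<lambda>y. enn2real (nn_marginal t y)) \<in> borel_measurable M"
    using assms by (intro measurable_cong) (simp add: fwd_marginal_eq)
  then show ?thesis
    using measurable_nn_marginal[OF assms] by simp
qed

lemma fwd_marginal_nonneg: "t \<in> {1..T} \<Longrightarrow> y \<in> space M \<Longrightarrow> 0 \<le> fwd_marginal M q T x0 t y"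
  by (simp add: fwd_marginal_eq)

text \<open>At time 1 no past state is left to integrate out. This is the lower end of the
  telescoping sum in \<open>ln_ratio_eq_sum\<close>.\<close>

lemma fwd_marginal_1: "1 \<le> T \<Longrightarrow> y \<in> space M \<Longrightarrow> fwd_marginal M q T x0 1 y = q 1 x0 y"
  by (simp add: fwd_marginal_eq nn_marginal_def fwd_joint_def PiM_empty nn_integral_count_space_finite
      q_nonneg x0)

section \<open>Laws of one state and of two consecutive states under the path law\<close>

lemma nn_integral_fwd_law:
  assumes "h \<in> borel_measurable (path_measure M {1..T})"
  shows "(\<integral>\<^sup>+x. h x \<partial>fwd_law M q T x0) =
    (\<integral>\<^sup>+x. ennreal (fwd_joint q T x0 x) * h x \<partial>path_measure M {1..T})"
  unfolding fwd_law_def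
  using measurable_fwd_joint[of T "{1..T}"] assms by (intro nn_integral_density) auto

text \<open>Tonelli with the state at \<open>t\<close> outermost: \<open>h\<close> is constant for
  the inner integral over the other states.\<close>

lemma nn_integral_fwd_law_component:
  assumes t: "t \<in> {1..T}" and h[measurable]: "h \<in> borel_measurable M"
  shows "(\<integral>\<^sup>+x. h (x t) \<partial>fwd_law M q T x0) = (\<integral>\<^sup>+y. nn_marginal t y * h y \<partial>M)"
proof -
  have I: "{1..T} = insert t ({1..T} - {t})"
    using t by auto
  have m: "(\<lambda>x. h (x t)) \<in> borel_measurable (path_measure M {1..T})"
    using t by measurable
  have "(\<integral>\<^sup>+x. h (x t) \<partial>fwd_law M q T x0) =
      (\<integral>\<^sup>+x. ennreal (fwd_joint q T x0 x) * h (x t) \<partial>path_measure M (insert t ({1..T} - {t})))"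
    using nn_integral_fwd_law[OF m] I by simp
  also have "\<dots> = (\<integral>\<^sup>+y. \<integral>\<^sup>+x. ennreal (fwd_joint q T x0 (x(t := y))) * h ((x(t := y)) t)
      \<partial>path_measure M ({1..T} - {t}) \<partial>M)"
    using m measurable_fwd_joint[of T "{1..T}"] I[symmetric]
    by (intro product_nn_integral_insert_rev) auto
  also have "\<dots> = (\<integral>\<^sup>+y. nn_marginal t y * h y \<partial>M)"
  proof (rule nn_integral_cong)
    fix y assume y: "y \<in> space M"
    have "(\<integral>\<^sup>+x. ennreal (fwd_joint q T x0 (x(t := y))) * h y \<partial>path_measure M ({1..T} - {t})) =
        (\<integral>\<^sup>+x. ennreal (fwd_joint q T x0 (x(t := y))) \<partial>path_measure M ({1..T} - {t})) * h y"
      using measurable_fwd_joint_upd[OF t order_refl y] by (intro nn_integral_multc) auto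
    then show "(\<integral>\<^sup>+x. ennreal (fwd_joint q T x0 (x(t := y))) * h ((x(t := y)) t)
        \<partial>path_measure M ({1..T} - {t})) = nn_marginal t y * h y"
      using nn_integral_fwd_joint_fix[OF t y] by simp
  qed
  finally show ?thesis .
qed

text \<open>The extended marginal has integral 1, so it is finite almost everywhere, and there
  \<open>enn2real\<close> loses nothing.\<close>

lemma AE_fwd_marginal_eq:
  assumes t: "t \<in> {1..T}"
  shows "AE y in M. ennreal (fwd_marginal M q T x0 t y) = nn_marginal t y"
proof -
  have "(\<integral>\<^sup>+y. nn_marginal t y \<partial>M) = 1"
    using nn_integral_fwd_law_component[OF t, of "\<lambda>_. 1"] nn_integral_fwd_law[of "\<lambda>_. 1"]
      nn_integral_fwd_joint by simp
  then have "AE y in M. nn_marginal t y \<noteq> \<infinity>"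
    using measurable_nn_marginal[OF t] by (intro nn_integral_PInf_AE) auto
  with AE_space show ?thesis
    by eventually_elim (use t in \<open>simp add: fwd_marginal_eq less_top\<close>)
qed

lemma nn_integral_fwd_marginal:
  assumes "t \<in> {1..T}"
  shows "(\<integral>\<^sup>+y. ennreal (fwd_marginal M q T x0 t y) \<partial>M) = 1"
proof -
  have "(\<integral>\<^sup>+y. ennreal (fwd_marginal M q T x0 t y) \<partial>M) = (\<integral>\<^sup>+y. nn_marginal t y \<partial>M)"
    using AE_fwd_marginal_eq[OF assms] by (rule nn_integral_cong_AE)
  then show ?thesis
    using nn_integral_fwd_law_component[OF assms, of "\<lambda>_. 1"] nn_integral_fwd_law[of "\<lambda>_. 1"]
      nn_integral_fwd_joint by simp
qed

lemma sets_fwd_law: "sets (fwd_law M q T x0) = sets (path_measure M {1..T})"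
  by (simp add: fwd_law_def)

lemma measurable_fwd_law: "measurable (fwd_law M q T x0) N = measurable (path_measure M {1..T}) N"
  by (rule measurable_cong_sets[OF sets_fwd_law refl])

text \<open>Identifies \<open>fwd_marginal_law\<close> as a push-forward of the path law, so that
  integrals and almost-sure statements can be moved between trajectories and single states.\<close>

lemma distr_fwd_law_component:
  assumes t: "t \<in> {1..T}"
  shows "distr (fwd_law M q T x0) M (\<lambda>x. x t) = fwd_marginal_law M q T x0 t"
proof (rule measure_eqI)
  show "sets (distr (fwd_law M q T x0) M (\<lambda>x. x t)) = sets (fwd_marginal_law M q T x0 t)"
    by (simp add: fwd_marginal_law_def)
next
  fix A assume "A \<in> sets (distr (fwd_law M q T x0) M (\<lambda>x. x t))"
  then have A[measurable]: "A \<in> sets M" by simp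
  have c: "(\<lambda>x. x t) \<in> measurable (fwd_law M q T x0) M"
    unfolding measurable_fwd_law using t by measurable
  have "emeasure (distr (fwd_law M q T x0) M (\<lambda>x. x t)) A =
      (\<integral>\<^sup>+y. indicator A y \<partial>distr (fwd_law M q T x0) M (\<lambda>x. x t))"
    by simp
  also have "\<dots> = (\<integral>\<^sup>+x. indicator A (x t) \<partial>fwd_law M q T x0)"
    by (rule nn_integral_distr[OF c]) auto
  also have "\<dots> = (\<integral>\<^sup>+y. nn_marginal t y * indicator A y \<partial>M)"
    by (rule nn_integral_fwd_law_component[OF t]) auto
  also have "\<dots> = (\<integral>\<^sup>+y. ennreal (fwd_marginal M q T x0 t y) * indicator A y \<partial>M)"
    using AE_fwd_marginal_eq[OF t] by (intro nn_integral_cong_AE) auto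
  also have "\<dots> = emeasure (fwd_marginal_law M q T x0 t) A"
    unfolding fwd_marginal_law_def using measurable_fwd_marginal[OF t]
    by (subst emeasure_density) auto
  finally show "emeasure (distr (fwd_law M q T x0) M (\<lambda>x. x t)) A =
      emeasure (fwd_marginal_law M q T x0 t) A" .
qed

text \<open>The arguments run against time, first the state at \<open>t\<close> and then the one at
  \<open>t - 1\<close>, to match the argument order of the reverse kernels and of the
  posterior.\<close>

abbreviation pair_density :: "nat \<Rightarrow> 'a \<times> 'a \<Rightarrow> real" where
  "pair_density t \<equiv> (\<lambda>(z, y). fwd_marginal M q T x0 (t - 1) y * q t y z)"

lemma measurable_pair_density:
  assumes "t \<in> {2..T}"
  shows "pair_density t \<in> borel_measurable (M \<Otimes>\<^sub>M M)"
  unfolding split_beta'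
  using assms by (intro borel_measurable_times measurable_q_comp
      measurable_compose[OF measurable_snd measurable_fwd_marginal]) auto

lemma pair_density_nonneg:
  assumes "t \<in> {2..T}" "w \<in> space (M \<Otimes>\<^sub>M M)"
  shows "0 \<le> pair_density t w"
  using assms by (auto simp: space_pair_measure split_beta' intro!: mult_nonneg_nonneg
      fwd_marginal_nonneg q_nonneg)

text \<open>The states at \<open>t\<close> and \<open>t - 1\<close> are split off in this order as
  outer integrals; the integral over all other states is then given by
  \<open>nn_integral_fwd_joint_fix2\<close>.\<close>

lemma nn_integral_fwd_law_pair:
  assumes t: "t \<in> {2..T}" and h[measurable]: "h \<in> borel_measurable (M \<Otimes>\<^sub>M M)"
  shows "(\<integral>\<^sup>+x. h (x t, x (t - 1)) \<partial>fwd_law M q T x0) =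
    (\<integral>\<^sup>+w. ennreal (pair_density t w) * h w \<partial>(M \<Otimes>\<^sub>M M))"
proof -
  let ?K = "{1..T} - {t - 1, t}"
  let ?F = "fwd_joint q T x0"
  have I: "{1..T} = insert t (insert (t - 1) ?K)" and tK: "t \<notin> insert (t - 1) ?K"
    using t by auto
  have m: "(\<lambda>x. h (x t, x (t - 1))) \<in> borel_measurable (path_measure M {1..T})"
    using t by (intro measurable_compose[OF _ h] measurable_Pair measurable_component_singleton) auto
  have FM: "?F \<in> borel_measurable (path_measure M {1..T})"
    by (rule measurable_fwd_joint) auto
  have "(\<integral>\<^sup>+x. h (x t, x (t - 1)) \<partial>fwd_law M q T x0) =
      (\<integral>\<^sup>+x. ennreal (?F x) * h (x t, x (t - 1)) \<partial>path_measure M (insert t (insert (t - 1) ?K)))"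
    using nn_integral_fwd_law[OF m] I by simp
  also have "\<dots> = (\<integral>\<^sup>+z. \<integral>\<^sup>+x. ennreal (?F (x(t := z))) * h ((x(t := z)) t, (x(t := z)) (t - 1))
      \<partial>path_measure M (insert (t - 1) ?K) \<partial>M)"
    using m FM I[symmetric] tK by (intro product_nn_integral_insert_rev) auto
  also have "\<dots> = (\<integral>\<^sup>+z. \<integral>\<^sup>+y. nn_marginal (t - 1) y * ennreal (q t y z) * h (z, y) \<partial>M \<partial>M)"
  proof (rule nn_integral_cong)
    fix z assume z: "z \<in> space M"
    have u: "(\<lambda>x. x(t := z)) \<in> measurable (path_measure M (insert (t - 1) ?K)) (path_measure M {1..T})"
      using z I by (intro measurable_fun_upd[where J = "insert (t - 1) ?K"]) auto
    have [simp]: "t - Suc 0 \<noteq> t"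
      using t by auto
    have "(\<lambda>x. ennreal (?F (x(t := z))) * h (z, x (t - 1)))
        \<in> borel_measurable (path_measure M (insert (t - 1) ?K))"
      using z by (intro borel_measurable_times_ennreal measurable_compose[OF _ measurable_ennreal]
          measurable_compose[OF u FM] measurable_compose[OF _ h]) auto
    then have "(\<integral>\<^sup>+x. ennreal (?F (x(t := z))) * h (z, x (t - 1))
          \<partial>path_measure M (insert (t - 1) ?K)) =
        (\<integral>\<^sup>+y. \<integral>\<^sup>+x. ennreal (?F (x(t - 1 := y, t := z))) * h (z, (x(t - 1 := y)) (t - 1))
          \<partial>path_measure M ?K \<partial>M)"
      by (intro product_nn_integral_insert_rev) auto
    also have "\<dots> = (\<integral>\<^sup>+y. nn_marginal (t - 1) y * ennreal (q t y z) * h (z, y) \<partial>M)"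
    proof (rule nn_integral_cong)
      fix y assume y: "y \<in> space M"
      have "(\<lambda>x. x(t - 1 := y, t := z)) \<in> measurable (path_measure M ?K) (path_measure M {1..T})"
        using t y z by (intro measurable_fun_upd[where J = "{1..T} - {t}"]
            measurable_fun_upd[where J = ?K]) auto
      from measurable_compose[OF this FM]
      have "(\<integral>\<^sup>+x. ennreal (?F (x(t - 1 := y, t := z))) * h (z, y) \<partial>path_measure M ?K) =
          (\<integral>\<^sup>+x. ennreal (?F (x(t - 1 := y, t := z))) \<partial>path_measure M ?K) * h (z, y)"
        by (intro nn_integral_multc) auto
      then show "(\<integral>\<^sup>+x. ennreal (?F (x(t - 1 := y, t := z))) * h (z, (x(t - 1 := y)) (t - 1))
          \<partial>path_measure M ?K) = nn_marginal (t - 1) y * ennreal (q t y z) * h (z, y)"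
        using nn_integral_fwd_joint_fix2[OF t y z] by simp
    qed
    finally show "(\<integral>\<^sup>+x. ennreal (?F (x(t := z))) * h ((x(t := z)) t, (x(t := z)) (t - 1))
          \<partial>path_measure M (insert (t - 1) ?K)) =
        (\<integral>\<^sup>+y. nn_marginal (t - 1) y * ennreal (q t y z) * h (z, y) \<partial>M)"
      by simp
  qed
  \<comment> \<open>For each \<open>z\<close> the extended marginal at \<open>t - 1\<close> may be
    replaced by the real one, since they agree for almost every \<open>y\<close>.\<close>
  also have "\<dots> = (\<integral>\<^sup>+z. \<integral>\<^sup>+y. ennreal (pair_density t (z, y)) * h (z, y) \<partial>M \<partial>M)"
  proof (rule nn_integral_cong, rule nn_integral_cong_AE)
    fix z assume z: "z \<in> space M"
    have "AE y in M. ennreal (fwd_marginal M q T x0 (t - 1) y) = nn_marginal (t - 1) y"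
      using t by (intro AE_fwd_marginal_eq) auto
    with AE_space show "AE y in M. nn_marginal (t - 1) y * ennreal (q t y z) * h (z, y) =
        ennreal (pair_density t (z, y)) * h (z, y)"
    proof eventually_elim
      case (elim y)
      then show ?case
        using t z by (simp add: ennreal_mult'' q_nonneg)
    qed
  qed
  also have "\<dots> = (\<integral>\<^sup>+w. ennreal (pair_density t w) * h w \<partial>(M \<Otimes>\<^sub>M M))"
    using measurable_pair_density[OF t] by (intro nn_integral_fst) auto
  finally show ?thesis .
qed

lemma distr_fwd_law_pair:
  assumes t: "t \<in> {2..T}"
  shows "distr (fwd_law M q T x0) (M \<Otimes>\<^sub>M M) (\<lambda>x. (x t, x (t - 1))) =
    density (M \<Otimes>\<^sub>M M) (pair_density t)" (is "?D = ?R")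
proof (rule measure_eqI)
  show "sets ?D = sets ?R"
    by simp
next
  fix A assume "A \<in> sets ?D"
  then have A[measurable]: "A \<in> sets (M \<Otimes>\<^sub>M M)" by simp
  have c: "(\<lambda>x. (x t, x (t - 1))) \<in> measurable (fwd_law M q T x0) (M \<Otimes>\<^sub>M M)"
    unfolding measurable_fwd_law using t by (intro measurable_Pair measurable_component_singleton) auto
  have "emeasure ?D A = (\<integral>\<^sup>+w. indicator A w \<partial>?D)"
    by simp
  also have "\<dots> = (\<integral>\<^sup>+x. indicator A (x t, x (t - 1)) \<partial>fwd_law M q T x0)"
    by (rule nn_integral_distr[OF c]) auto
  also have "\<dots> = (\<integral>\<^sup>+w. ennreal (pair_density t w) * indicator A w \<partial>(M \<Otimes>\<^sub>M M))"
    by (rule nn_integral_fwd_law_pair[OF t]) auto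
  also have "\<dots> = emeasure ?R A"
    using measurable_pair_density[OF t] by (subst emeasure_density) auto
  finally show "emeasure ?D A = emeasure ?R A" .
qed

end

section \<open>Integrability of log ratios, and divergences without absolute continuity\<close>

lemma integrable_neg_part_ln_ratio:
  fixes f g :: "'a \<Rightarrow> real"
  assumes f[measurable]: "f \<in> borel_measurable N" and g[measurable]: "g \<in> borel_measurable N"
    and f0: "\<And>x. x \<in> space N \<Longrightarrow> 0 \<le> f x" and g0: "\<And>x. x \<in> space N \<Longrightarrow> 0 \<le> g x"
    and fin: "(\<integral>\<^sup>+x. ennreal (g x) \<partial>N) < \<infinity>"
  shows "integrable (density N (\<lambda>x. ennreal (f x))) (\<lambda>x. max 0 (- ln (f x / g x)))"
proof -
  have "integrable N g"
    using g0 fin by (intro integrableI_nonneg AE_I2) auto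
  then have "integrable N (\<lambda>x. f x *\<^sub>R max 0 (- ln (f x / g x)))"
  proof (rule Bochner_Integration.integrable_bound)
    show "AE x in N. norm (f x *\<^sub>R max 0 (- ln (f x / g x))) \<le> norm (g x)"
    proof (rule AE_I2)
      fix x assume x: "x \<in> space N"
      show "norm (f x *\<^sub>R max 0 (- ln (f x / g x))) \<le> norm (g x)"
      \<comment> \<open>If \<open>f x = 0\<close> the weight removes the term; if
        \<open>g x = 0\<close> the quotient is 0 and \<open>ln 0 = 0\<close>.\<close>
      proof (cases "f x = 0 \<or> g x = 0")
        case False
        then have pos: "0 < f x" "0 < g x"
          using f0[OF x] g0[OF x] by auto
        have "- ln (f x / g x) = ln (g x / f x)"
          using pos by (simp add: ln_div)
        also have "\<dots> \<le> g x / f x"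
          using ln_le_minus_one[of "g x / f x"] pos by simp
        finally have "f x * max 0 (- ln (f x / g x)) \<le> f x * (g x / f x)"
          using pos by (intro mult_left_mono) auto
        then show ?thesis
          using pos by simp
      qed auto
    qed
  qed measurable
  then show ?thesis
    using f0 by (subst integrable_density) auto
qed

text \<open>A summand is the total minus the other summands, so it is at most the total plus their
  negative parts; from below it is bounded by its own negative part.\<close>

lemma integrable_summand_of_neg_parts:
  fixes f :: "'i \<Rightarrow> 'a \<Rightarrow> real"
  assumes S: "finite S" "i \<in> S"
    and f: "\<And>j. j \<in> S \<Longrightarrow> f j \<in> borel_measurable N"
    and sum: "integrable N (\<lambda>x. \<Sum>j\<in>S. f j x)"
    and neg: "\<And>j. j \<in> S \<Longrightarrow> integrable N (\<lambda>x. max 0 (- f j x))"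
  shows "integrable N (f i)"
proof (rule Bochner_Integration.integrable_bound)
  show "integrable N (\<lambda>x. \<bar>\<Sum>j\<in>S. f j x\<bar> + (\<Sum>j\<in>S. max 0 (- f j x)))"
    using neg by (intro Bochner_Integration.integrable_add integrable_abs[OF sum]
        Bochner_Integration.integrable_sum)
  show "f i \<in> borel_measurable N"
    using f S by auto
  show "AE x in N. norm (f i x) \<le> norm (\<bar>\<Sum>j\<in>S. f j x\<bar> + (\<Sum>j\<in>S. max 0 (- f j x)))"
  proof (rule AE_I2)
    fix x
    have split: "(\<Sum>j\<in>S. g j) = g i + (\<Sum>j\<in>S - {i}. g j)" for g :: "'i \<Rightarrow> real"
      using S by (rule sum.remove)
    have "- (\<Sum>j\<in>S - {i}. f j x) \<le> (\<Sum>j\<in>S - {i}. max 0 (- f j x))"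
      unfolding sum_negf[symmetric] by (rule sum_mono) auto
    moreover have "0 \<le> (\<Sum>j\<in>S - {i}. max 0 (- f j x))"
      by (rule sum_nonneg) auto
    ultimately show "norm (f i x) \<le> norm (\<bar>\<Sum>j\<in>S. f j x\<bar> + (\<Sum>j\<in>S. max 0 (- f j x)))"
      using split[of "\<lambda>j. f j x"] split[of "\<lambda>j. max 0 (- f j x)"] by auto
  qed
qed

text \<open>A derivative \<open>h\<close> would force \<open>g\<close> to vanish almost everywhere
  that \<open>f\<close> does. As none exists, \<open>RN_deriv\<close> takes its default value 0, and
  the logarithm of 0 is 0.\<close>

lemma (in sigma_finite_measure) KL_density_density_not_ac:
  fixes f g :: "'a \<Rightarrow> real"
  assumes [measurable]: "f \<in> borel_measurable M" "g \<in> borel_measurable M"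
    and g0: "\<And>x. x \<in> space M \<Longrightarrow> 0 \<le> g x"
    and nac: "\<not> (AE x in M. f x = 0 \<longrightarrow> g x = 0)"
  shows "KL_divergence b (density M (\<lambda>x. ennreal (f x))) (density M (\<lambda>x. ennreal (g x))) = 0"
proof -
  let ?f = "density M (\<lambda>x. ennreal (f x))" and ?g = "density M (\<lambda>x. ennreal (g x))"
  have False if h: "h \<in> borel_measurable ?f" "density ?f h = ?g" for h
  proof -
    have [measurable]: "h \<in> borel_measurable M"
      using h by simp
    have "density M (\<lambda>x. ennreal (f x) * h x) = ?g"
      using h by (simp add: density_density_eq)
    then have "AE x in M. ennreal (f x) * h x = ennreal (g x)"
      by (intro density_unique) auto
    with AE_space have "AE x in M. f x = 0 \<longrightarrow> g x = 0"
      by eventually_elim (use g0 in force)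
    with nac show False ..
  qed
  then have "RN_deriv ?f ?g = (\<lambda>_. 0)"
    unfolding RN_deriv_def by meson
  then show ?thesis
    by (simp add: KL_divergence_def entropy_density_def comp_def log_def)
qed

lemma ln_mult_prod:
  fixes c :: real
  assumes "finite S" "0 < c" and pos: "\<And>i. i \<in> S \<Longrightarrow> 0 < f i"
  shows "ln (c * (\<Prod>i\<in>S. f i)) = ln c + (\<Sum>i\<in>S. ln (f i))"
proof -
  have "ln (\<Prod>i\<in>S. f i) = (\<Sum>i\<in>S. ln (f i))"
    using assms(1) by (rule ln_prod) (use pos in force)
  then show ?thesis
    using assms prod_pos[of S f] by (simp add: ln_mult_pos)
qed

section \<open>Reverse density of the latent states, and transfer from the path law to single states
  and pairs\<close>

locale diffusion = forward_process M q T x0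
  for M :: "'a measure" and q :: "nat \<Rightarrow> 'a \<Rightarrow> 'a \<Rightarrow> real" and T :: nat and x0 :: 'a +
  fixes p :: "nat \<Rightarrow> 'a \<Rightarrow> 'a \<Rightarrow> real" and prior :: "'a \<Rightarrow> real"
  assumes p: "\<And>t. t \<in> {1..T} \<Longrightarrow> transition_density M (p t)"
    and prior: "prob_density M prior"
    and T: "1 \<le> T"
begin

abbreviation "L \<equiv> fwd_law M q T x0"
abbreviation "m \<equiv> fwd_marginal M q T x0"

lemma measurable_p: "t \<in> {1..T} \<Longrightarrow> case_prod (p t) \<in> borel_measurable (M \<Otimes>\<^sub>M M)"
  using p by (auto simp: transition_density_def)

lemma p_nonneg: "t \<in> {1..T} \<Longrightarrow> a \<in> space M \<Longrightarrow> b \<in> space M \<Longrightarrow> 0 \<le> p t a b"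
  using p by (auto simp: transition_density_def prob_density_def)

lemma nn_integral_p: "t \<in> {1..T} \<Longrightarrow> a \<in> space M \<Longrightarrow> (\<integral>\<^sup>+b. ennreal (p t a b) \<partial>M) = 1"
  using p by (auto simp: transition_density_def prob_density_def)

lemma measurable_p_comp:
  assumes "t \<in> {1..T}" "f \<in> measurable N M" "g \<in> measurable N M"
  shows "(\<lambda>x. p t (f x) (g x)) \<in> borel_measurable N"
  using measurable_compose[OF measurable_Pair[OF assms(2,3)] measurable_p[OF assms(1)]] by simp

lemma measurable_prior: "prior \<in> borel_measurable M"
  using prior by (simp add: prob_density_def)

lemma prior_nonneg: "a \<in> space M \<Longrightarrow> 0 \<le> prior a"
  using prior by (simp add: prob_density_def)

text \<open>Only the reverse kernel at time 1 reads the state at time 0; all other factors can leave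
  the integral over that state.\<close>

lemma rev_joint_upd:
  "rev_joint p prior T (x(0 := y)) =
    prior (x T) * (\<Prod>t=2..T. p t (x t) (x (t - 1))) * p 1 (x 1) y"
proof -
  have "(\<Prod>t=1..T. p t ((x(0 := y)) t) ((x(0 := y)) (t - 1))) =
      p 1 (x 1) y * (\<Prod>t=2..T. p t ((x(0 := y)) t) ((x(0 := y)) (t - 1)))"
    using T by (simp add: prod.atLeast_Suc_atMost numeral_2_eq_2)
  also have "(\<Prod>t=2..T. p t ((x(0 := y)) t) ((x(0 := y)) (t - 1))) =
      (\<Prod>t=2..T. p t (x t) (x (t - 1)))"
    by (rule prod.cong) auto
  finally show ?thesis
    using T by (simp add: rev_joint_def)
qed

text \<open>Integrating out the state at time 0 removes the reverse kernel at time 1, which has mass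
  1 in its second argument.\<close>

lemma rev_latent_eq:
  assumes "x \<in> space (path_measure M {1..T})"
  shows "rev_latent M p prior T x = prior (x T) * (\<Prod>t=2..T. p t (x t) (x (t - 1)))"
proof -
  have 1: "1 \<in> {1..T}" and x1: "x 1 \<in> space M"
    using assms T by (auto simp: space_PiM)
  have "(\<integral>y. p 1 (x 1) y \<partial>M) = enn2real (\<integral>\<^sup>+y. ennreal (p 1 (x 1) y) \<partial>M)"
    using x1 by (intro integral_eq_nn_integral measurable_p_comp[OF 1] AE_I2 p_nonneg[OF 1]) auto
  then have "(\<integral>y. p 1 (x 1) y \<partial>M) = 1"
    using nn_integral_p[OF 1 x1] by simp
  then show ?thesis
    by (simp add: rev_latent_def rev_joint_upd)
qed

lemma fwd_joint_split:
  "fwd_joint q T x0 x = q 1 x0 (x 1) * (\<Prod>t=2..T. q t (x (t - 1)) (x t))"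
proof -
  have "fwd_joint q T x0 x = q 1 x0 (x 1) * (\<Prod>t=2..T. q t ((x(0 := x0)) (t - 1)) (x t))"
    using T by (simp add: fwd_joint_def prod.atLeast_Suc_atMost numeral_2_eq_2)
  \<comment> \<open>From \<open>t = 2\<close> on the predecessor time is at least 1, so the update
    at 0 is not seen.\<close>
  also have "(\<Prod>t=2..T. q t ((x(0 := x0)) (t - 1)) (x t)) = (\<Prod>t=2..T. q t (x (t - 1)) (x t))"
    by (rule prod.cong) auto
  finally show ?thesis .
qed

lemma space_L: "space L = space (path_measure M {1..T})"
  by (simp add: fwd_law_def)

lemma state_in_space: "x \<in> space L \<Longrightarrow> t \<in> {1..T} \<Longrightarrow> x t \<in> space M"
  by (auto simp: space_L space_PiM)

lemma measurable_state: "t \<in> {1..T} \<Longrightarrow> (\<lambda>x. x t) \<in> measurable L M"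
  unfolding measurable_fwd_law by (rule measurable_component_singleton)

lemma measurable_state_pair:
  "t \<in> {2..T} \<Longrightarrow> (\<lambda>x. (x t, x (t - 1))) \<in> measurable L (M \<Otimes>\<^sub>M M)"
  by (intro measurable_Pair measurable_state) auto

text \<open>By push-forward the claim concerns a single state, and a law with a density sees only
  the set where the density is positive.\<close>

lemma AE_fwd_marginal_iff:
  assumes t: "t \<in> {1..T}" and P: "{y \<in> space M. P y} \<in> sets M"
  shows "(AE x in L. P (x t)) \<longleftrightarrow> (AE y in M. 0 < m t y \<longrightarrow> P y)"
proof -
  have "(AE x in L. P (x t)) \<longleftrightarrow> (AE y in fwd_marginal_law M q T x0 t. P y)"
    unfolding distr_fwd_law_component[OF t, symmetric]
    by (rule AE_distr_iff[symmetric, OF measurable_state[OF t] P])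
  also have "\<dots> \<longleftrightarrow> (AE y in M. 0 < m t y \<longrightarrow> P y)"
    unfolding fwd_marginal_law_def using measurable_fwd_marginal[OF t] by (subst AE_density) auto
  finally show ?thesis .
qed

lemma AE_pair_density_iff:
  assumes t: "t \<in> {2..T}" and P: "{w \<in> space (M \<Otimes>\<^sub>M M). P w} \<in> sets (M \<Otimes>\<^sub>M M)"
  shows "(AE x in L. P (x t, x (t - 1))) \<longleftrightarrow> (AE w in M \<Otimes>\<^sub>M M. 0 < pair_density t w \<longrightarrow> P w)"
proof -
  have "(AE x in L. P (x t, x (t - 1))) \<longleftrightarrow> (AE w in density (M \<Otimes>\<^sub>M M) (pair_density t). P w)"
    unfolding distr_fwd_law_pair[OF t, symmetric]
    by (rule AE_distr_iff[symmetric, OF measurable_state_pair[OF t] P])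
  also have "\<dots> \<longleftrightarrow> (AE w in M \<Otimes>\<^sub>M M. 0 < pair_density t w \<longrightarrow> P w)"
    using measurable_pair_density[OF t] by (subst AE_density) auto
  finally show ?thesis .
qed

lemma AE_fwd_marginal_pos:
  assumes t: "t \<in> {1..T}"
  shows "AE x in L. 0 < m t (x t)"
proof -
  have [measurable]: "m t \<in> borel_measurable M"
    by (rule measurable_fwd_marginal[OF t])
  show ?thesis
    using AE_fwd_marginal_iff[OF t, of "\<lambda>y. 0 < m t y"] by simp
qed

lemma integral_fwd_law_state:
  fixes h :: "'a \<Rightarrow> real"
  assumes t: "t \<in> {1..T}" and h: "h \<in> borel_measurable M"
  shows "(\<integral>x. h (x t) \<partial>L) = (\<integral>y. h y \<partial>fwd_marginal_law M q T x0 t)"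
  unfolding distr_fwd_law_component[OF t, symmetric]
  by (rule integral_distr[symmetric, OF measurable_state[OF t] h])

section \<open>First identity: the expected log conditional density of the starting point\<close>

lemma expectation_ln_rev_cond:
  assumes "log_expectation_defined L (rev_cond M p prior T x0)"
  shows "(\<integral>x. ln (rev_cond M p prior T x0 x) \<partial>L) =
    (\<integral>y. ln (p 1 y x0) \<partial>fwd_marginal_law M q T x0 1)"
proof -
  have 1: "1 \<in> {1..T}"
    using T by simp
  have m: "(\<lambda>y. ln (p 1 y x0)) \<in> borel_measurable M"
    using x0 by (intro borel_measurable_ln measurable_p_comp[OF 1]) auto
  have "AE x in L. 0 < rev_cond M p prior T x0 x"
    using assms by (simp add: log_expectation_defined_def)
  with AE_space have "AE x in L. ln (rev_cond M p prior T x0 x) = ln (p 1 (x 1) x0)"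
  proof eventually_elim
    case (elim x)
    let ?c = "rev_latent M p prior T x"
    \<comment> \<open>The joint density at \<open>x0\<close> is the latent density times
      \<open>p 1 (x 1) x0\<close>. A vanishing denominator would make the quotient 0, against
      positivity, so the common factor cancels.\<close>
    have "rev_cond M p prior T x0 x = ?c * p 1 (x 1) x0 / ?c"
      using elim(1) by (simp only: rev_cond_def rev_joint_upd rev_latent_eq space_L)
    with elim(2) show ?case
      by auto
  qed
  then have "(\<integral>x. ln (rev_cond M p prior T x0 x) \<partial>L) = (\<integral>x. ln (p 1 (x 1) x0) \<partial>L)"
    using assms measurable_compose[OF measurable_state[OF 1] m]
    by (intro integral_cong_AE) (auto simp: log_expectation_defined_def)
  also have "\<dots> = (\<integral>y. ln (p 1 y x0) \<partial>fwd_marginal_law M q T x0 1)"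
    by (rule integral_fwd_law_state[OF 1 m])
  finally show ?thesis .
qed

section \<open>Second identity: prior and step terms as expected log ratios\<close>

definition prior_term :: "(nat \<Rightarrow> 'a) \<Rightarrow> real" where
  "prior_term x = ln (m T (x T) / prior (x T))"

text \<open>The log ratio of the posterior to \<open>p t\<close>, with the denominator of the
  posterior moved next to \<open>p t\<close>. Both parts of the fraction are then densities on
  pairs, as \<open>integrable_neg_part_ln_ratio\<close> wants.\<close>

definition step_term :: "nat \<Rightarrow> 'a \<times> 'a \<Rightarrow> real" where
  "step_term t w = ln (pair_density t w / (m t (fst w) * p t (fst w) (snd w)))"

lemma measurable_prior_term: "prior_term \<in> borel_measurable L"
proof -
  have "T \<in> {1..T}"
    using T by simp
  then show ?thesis
    unfolding prior_term_def
    by (intro borel_measurable_ln borel_measurable_divide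
        measurable_compose[OF measurable_state measurable_fwd_marginal]
        measurable_compose[OF measurable_state measurable_prior])
qed

lemma measurable_m_mult_p:
  assumes "t \<in> {2..T}"
  shows "(\<lambda>w. m t (fst w) * p t (fst w) (snd w)) \<in> borel_measurable (M \<Otimes>\<^sub>M M)"
  using assms by (intro borel_measurable_times measurable_p_comp
      measurable_compose[OF measurable_fst measurable_fwd_marginal]) auto

lemma measurable_step_term:
  assumes "t \<in> {2..T}"
  shows "step_term t \<in> borel_measurable (M \<Otimes>\<^sub>M M)"
  unfolding step_term_def
  by (intro borel_measurable_ln borel_measurable_divide measurable_m_mult_p[OF assms]
      measurable_pair_density[OF assms])

lemma integrable_prior_term_neg: "integrable L (\<lambda>x. max 0 (- prior_term x))"
proof -
  have T1: "T \<in> {1..T}"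
    using T by simp
  have mT: "m T \<in> borel_measurable M"
    by (rule measurable_fwd_marginal[OF T1])
  have "integrable (fwd_marginal_law M q T x0 T) (\<lambda>y. max 0 (- ln (m T y / prior y)))"
    unfolding fwd_marginal_law_def
    using prior fwd_marginal_nonneg[OF T1] mT
    by (intro integrable_neg_part_ln_ratio) (auto simp: prob_density_def)
  then have "integrable (distr L M (\<lambda>x. x T)) (\<lambda>y. max 0 (- ln (m T y / prior y)))"
    by (simp add: distr_fwd_law_component[OF T1])
  then show ?thesis
    unfolding prior_term_def by (rule integrable_distr[OF measurable_state[OF T1]])
qed

lemma integrable_step_term_neg:
  assumes t: "t \<in> {2..T}"
  shows "integrable L (\<lambda>x. max 0 (- step_term t (x t, x (t - 1))))"
proof -
  have t1: "t \<in> {1..T}"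
    using t by auto
  have [measurable]: "m t \<in> borel_measurable M"
    by (rule measurable_fwd_marginal[OF t1])
  have mm: "(\<lambda>w. ennreal (m t (fst w) * p t (fst w) (snd w))) \<in> borel_measurable (M \<Otimes>\<^sub>M M)"
    using measurable_m_mult_p[OF t] by simp
  \<comment> \<open>This is the density of a pair whose first state follows the forward marginal at
    \<open>t\<close> and whose second is drawn from the reverse kernel, so its mass is 1.\<close>
  have "(\<integral>\<^sup>+w. ennreal (m t (fst w) * p t (fst w) (snd w)) \<partial>(M \<Otimes>\<^sub>M M)) =
      (\<integral>\<^sup>+z. \<integral>\<^sup>+y. ennreal (m t z * p t z y) \<partial>M \<partial>M)"
    using nn_integral_fst[OF mm] by simp
  also have "\<dots> = (\<integral>\<^sup>+z. ennreal (m t z) \<partial>M)"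
  proof (rule nn_integral_cong)
    fix z assume z: "z \<in> space M"
    have "(\<integral>\<^sup>+y. ennreal (m t z * p t z y) \<partial>M) = (\<integral>\<^sup>+y. ennreal (m t z) * ennreal (p t z y) \<partial>M)"
      using fwd_marginal_nonneg[OF t1 z] by (simp add: ennreal_mult')
    also have "\<dots> = ennreal (m t z) * (\<integral>\<^sup>+y. ennreal (p t z y) \<partial>M)"
      using z by (intro nn_integral_cmult measurable_compose[OF measurable_p_comp[OF t1]
            measurable_ennreal]) auto
    finally show "(\<integral>\<^sup>+y. ennreal (m t z * p t z y) \<partial>M) = ennreal (m t z)"
      using nn_integral_p[OF t1 z] by simp
  qed
  also have "\<dots> = 1"
    by (rule nn_integral_fwd_marginal[OF t1])
  finally have "integrable (density (M \<Otimes>\<^sub>M M) (\<lambda>w. ennreal (pair_density t w)))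
      (\<lambda>w. max 0 (- step_term t w))"
    unfolding step_term_def
    using t1 by (intro integrable_neg_part_ln_ratio measurable_pair_density[OF t]
        measurable_m_mult_p[OF t] pair_density_nonneg[OF t])
      (auto simp: space_pair_measure intro!: mult_nonneg_nonneg fwd_marginal_nonneg p_nonneg)
  then have "integrable (distr L (M \<Otimes>\<^sub>M M) (\<lambda>x. (x t, x (t - 1)))) (\<lambda>w. max 0 (- step_term t w))"
    by (subst distr_fwd_law_pair[OF t])
  then show ?thesis
    by (rule integrable_distr[OF measurable_state_pair[OF t]])
qed

text \<open>Positivity of the prior along the path law is absolute continuity of the marginal at
  \<open>T\<close>, which gives access to the density formula for the divergence.\<close>

lemma KL_prior:
  assumes "AE x in L. 0 < prior (x T)"
  shows "KL (fwd_marginal_law M q T x0 T) (density M (\<lambda>y. ennreal (prior y))) =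
    (\<integral>x. prior_term x \<partial>L)"
proof -
  have T1: "T \<in> {1..T}"
    using T by simp
  have [measurable]: "m T \<in> borel_measurable M" "prior \<in> borel_measurable M"
    by (auto intro: measurable_fwd_marginal[OF T1] measurable_prior)
  have "AE y in M. 0 < m T y \<longrightarrow> 0 < prior y"
    using assms AE_fwd_marginal_iff[OF T1, of "\<lambda>y. 0 < prior y"] by simp
  with AE_space have ac: "AE y in M. prior y = 0 \<longrightarrow> m T y = 0"
    by eventually_elim (use fwd_marginal_nonneg[OF T1] in force)
  have "KL (fwd_marginal_law M q T x0 T) (density M (\<lambda>y. ennreal (prior y))) =
      (\<integral>y. m T y * log (exp 1) (m T y / prior y) \<partial>M)"
    unfolding fwd_marginal_law_def using ac prior_nonneg fwd_marginal_nonneg[OF T1]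
    by (intro KL_density_density) auto
  also have "\<dots> = (\<integral>y. ln (m T y / prior y) \<partial>fwd_marginal_law M q T x0 T)"
    unfolding fwd_marginal_law_def using fwd_marginal_nonneg[OF T1]
    by (subst integral_density) (auto simp: log_def)
  also have "\<dots> = (\<integral>x. prior_term x \<partial>L)"
    unfolding prior_term_def
    by (rule integral_fwd_law_state[OF T1, symmetric]) measurable
  finally show ?thesis .
qed

text \<open>
  The divergence is measurable in \<open>z\<close> also where the posterior is not absolutely continuous with
  respect to \<open>p t z\<close>: there the library's \<^const>\<open>KL_divergence\<close> is 0.
\<close>

lemma expectation_KL_posterior:
  assumes t: "t \<in> {2..T}" and p_pos: "AE x in L. 0 < p t (x t) (x (t - 1))"
    and int: "integrable L (\<lambda>x. step_term t (x t, x (t - 1)))"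
  shows "(\<integral>z. KL (density M (\<lambda>y. ennreal (fwd_posterior M q T x0 t z y)))
        (density M (\<lambda>y. ennreal (p t z y))) \<partial>fwd_marginal_law M q T x0 t) =
    (\<integral>x. step_term t (x t, x (t - 1)) \<partial>L)"
proof -
  let ?r = "fwd_posterior M q T x0 t"
  let ?K = "\<lambda>z. KL (density M (\<lambda>y. ennreal (?r z y))) (density M (\<lambda>y. ennreal (p t z y)))"
  let ?I = "\<lambda>z. \<integral>y. ?r z y * ln (?r z y / p t z y) \<partial>M"
  let ?f = "\<lambda>w. pair_density t w * step_term t w"
  have t1: "t \<in> {1..T}"
    using t by auto
  have mt[measurable]: "m t \<in> borel_measurable M"
    by (rule measurable_fwd_marginal[OF t1])
  have pt[measurable]: "case_prod (p t) \<in> borel_measurable (M \<Otimes>\<^sub>M M)"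
    by (rule measurable_p[OF t1])
  have pd[measurable]: "pair_density t \<in> borel_measurable (M \<Otimes>\<^sub>M M)"
    by (rule measurable_pair_density[OF t])
  have r_eq: "?r z y = pair_density t (z, y) / m t z" if "z \<in> space M" "y \<in> space M" for z y
    using fwd_pair_marginal_eq[OF t that(2,1)] by (simp add: fwd_posterior_def)
  have r0: "0 \<le> ?r z y" if "z \<in> space M" "y \<in> space M" for z y
    using pair_density_nonneg[OF t, of "(z, y)"] fwd_marginal_nonneg[OF t1] that
    by (simp add: r_eq space_pair_measure)
  have r[measurable]: "case_prod ?r \<in> borel_measurable (M \<Otimes>\<^sub>M M)"
  proof -
    have "case_prod ?r \<in> borel_measurable (M \<Otimes>\<^sub>M M) \<longleftrightarrow>
        (\<lambda>w. pair_density t w / m t (fst w)) \<in> borel_measurable (M \<Otimes>\<^sub>M M)"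
      by (rule measurable_cong) (auto simp: space_pair_measure r_eq)
    then show ?thesis
      using borel_measurable_divide[OF pd measurable_compose[OF measurable_fst mt]] by blast
  qed
  let ?ac = "\<lambda>z. AE y in M. p t z y = 0 \<longrightarrow> ?r z y = 0"
  have K_eq: "?K z = (if ?ac z then ?I z else 0)" if z: "z \<in> space M" for z
  proof -
    have [measurable]: "(\<lambda>y. ?r z y) \<in> borel_measurable M" "(\<lambda>y. p t z y) \<in> borel_measurable M"
      using measurable_compose[OF measurable_Pair1'[OF z] r]
        measurable_compose[OF measurable_Pair1'[OF z] pt] by auto
    show ?thesis
    proof (cases "?ac z")
      case True
      then have "?K z = (\<integral>y. ?r z y * log (exp 1) (?r z y / p t z y) \<partial>M)"
        using z r0 p_nonneg[OF t1] by (intro KL_density_density) auto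
      then show ?thesis
        using True by (simp add: log_def)
    next
      case False
      then have "?K z = 0"
        using z r0 by (intro KL_density_density_not_ac) auto
      then show ?thesis
        using False by simp
    qed
  qed
  have K: "?K \<in> borel_measurable M"
  proof -
    \<comment> \<open>Absolute continuity at \<open>z\<close> means that the section of
      \<open>?N\<close> at \<open>z\<close> is a null set, and the measure of a section depends
      measurably on \<open>z\<close>.\<close>
    let ?N = "{w \<in> space (M \<Otimes>\<^sub>M M). p t (fst w) (snd w) = 0 \<and> ?r (fst w) (snd w) \<noteq> 0}"
    have N[measurable]: "?N \<in> sets (M \<Otimes>\<^sub>M M)"
      by measurable
    have ac_iff: "?ac z \<longleftrightarrow> emeasure M (Pair z -` ?N) = 0" if z: "z \<in> space M" for z
      using sets_Pair1[OF N, of z] z by (intro AE_iff_measurable) (auto simp: space_pair_measure)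
    have "?K \<in> borel_measurable M \<longleftrightarrow>
        (\<lambda>z. if emeasure M (Pair z -` ?N) = 0 then ?I z else 0) \<in> borel_measurable M"
      by (rule measurable_cong) (simp add: K_eq ac_iff)
    moreover have "(\<lambda>z. if emeasure M (Pair z -` ?N) = 0 then ?I z else 0) \<in> borel_measurable M"
      by (intro measurable_If borel_measurable_lebesgue_integral
          borel_measurable_eq measurable_emeasure_Pair[OF N]) measurable
    ultimately show ?thesis
      by simp
  qed
  have "AE w in M \<Otimes>\<^sub>M M. 0 < pair_density t w \<longrightarrow> 0 < p t (fst w) (snd w)"
    using p_pos by (subst AE_pair_density_iff[OF t, symmetric]) auto
  moreover have "AE w in M \<Otimes>\<^sub>M M. 0 < pair_density t w \<longrightarrow> 0 < m t (fst w)"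
    using AE_fwd_marginal_pos[OF t1] by (subst AE_pair_density_iff[OF t, symmetric]) auto
  ultimately have "AE w in M \<Otimes>\<^sub>M M. 0 < pair_density t w \<longrightarrow>
      0 < p t (fst w) (snd w) \<and> 0 < m t (fst w)"
    by eventually_elim auto
  \<comment> \<open>A null set of pairs has null sections for almost every \<open>z\<close>; this
    yields absolute continuity of the posterior for almost every \<open>z\<close>.\<close>
  then have pos: "AE z in M. AE y in M. 0 < pair_density t (z, y) \<longrightarrow> 0 < p t z y \<and> 0 < m t z"
    using pair.AE_pair by fastforce
  have "integrable (distr L (M \<Otimes>\<^sub>M M) (\<lambda>x. (x t, x (t - 1)))) (step_term t)"
    using int integrable_distr_eq[OF measurable_state_pair[OF t] measurable_step_term[OF t]] by simp
  \<comment> \<open>Joint integrability is what lets Fubini turn the iterated integral over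
    \<open>z\<close> and \<open>y\<close> into one integral over pairs.\<close>
  then have f_int: "integrable (M \<Otimes>\<^sub>M M) ?f"
    unfolding distr_fwd_law_pair[OF t]
    using pair_density_nonneg[OF t]
    by (subst (asm) integrable_density[OF measurable_step_term[OF t] pd]) auto
  have AE_eq: "AE z in M. m t z * ?K z = (\<integral>y. ?f (z, y) \<partial>M)"
    using AE_space pos
  proof eventually_elim
    case (elim z)
    note z = elim(1)
    have [measurable]: "(\<lambda>y. ?r z y) \<in> borel_measurable M" "(\<lambda>y. p t z y) \<in> borel_measurable M"
      using measurable_compose[OF measurable_Pair1'[OF z] r]
        measurable_compose[OF measurable_Pair1'[OF z] pt] by auto
    have fm: "(\<lambda>y. ?f (z, y)) \<in> borel_measurable M"
      using measurable_compose[OF measurable_Pair1'[OF z] borel_measurable_integrable[OF f_int]] .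
    have pz: "AE y in M. y \<in> space M \<and> 0 \<le> pair_density t (z, y) \<and>
        (0 < pair_density t (z, y) \<longrightarrow> 0 < p t z y \<and> 0 < m t z)"
      using AE_space elim(2)
      by eventually_elim (use z pair_density_nonneg[OF t] in \<open>auto simp: space_pair_measure\<close>)
    then have "?ac z"
      by eventually_elim (use z r_eq in force)
    then have "m t z * ?K z = m t z * ?I z"
      by (simp add: K_eq[OF z])
    also have "\<dots> = (\<integral>y. m t z * (?r z y * ln (?r z y / p t z y)) \<partial>M)"
      by simp
    also have "\<dots> = (\<integral>y. ?f (z, y) \<partial>M)"
    proof (rule integral_cong_AE)
      \<comment> \<open>Where the pair density vanishes both sides are 0; elsewhere
        \<open>m t z\<close> is positive and cancels against the denominator of the
        posterior.\<close>
      show "AE y in M. m t z * (?r z y * ln (?r z y / p t z y)) = ?f (z, y)"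
        using pz
      proof eventually_elim
        case (elim y)
        then show ?case
          using r_eq[OF z, of y]
          by (cases "pair_density t (z, y) = 0") (auto simp: step_term_def)
      qed
    qed (use fm in measurable)
    finally show ?case .
  qed
  have "(\<integral>z. ?K z \<partial>fwd_marginal_law M q T x0 t) = (\<integral>z. m t z * ?K z \<partial>M)"
    unfolding fwd_marginal_law_def using K fwd_marginal_nonneg[OF t1]
    by (subst integral_density) auto
  also have "\<dots> = (\<integral>z. \<integral>y. ?f (z, y) \<partial>M \<partial>M)"
  proof (rule integral_cong_AE)
    show "(\<lambda>z. \<integral>y. ?f (z, y) \<partial>M) \<in> borel_measurable M"
      by (rule borel_measurable_lebesgue_integral)
        (use borel_measurable_integrable[OF f_int] in \<open>simp add: split_beta'\<close>)
  qed (use K AE_eq in simp_all)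
  also have "\<dots> = (\<integral>w. ?f w \<partial>(M \<Otimes>\<^sub>M M))"
    by (rule pair.integral_fst'[OF f_int])
  also have "\<dots> = (\<integral>w. step_term t w \<partial>density (M \<Otimes>\<^sub>M M) (pair_density t))"
    using pair_density_nonneg[OF t]
    by (subst integral_density[OF measurable_step_term[OF t] pd]) auto
  also have "\<dots> = (\<integral>x. step_term t (x t, x (t - 1)) \<partial>L)"
    unfolding distr_fwd_law_pair[OF t, symmetric]
    by (rule integral_distr[OF measurable_state_pair[OF t] measurable_step_term[OF t]])
  finally show ?thesis .
qed

section \<open>Telescoping of the log ratio of the path densities\<close>

lemma ln_ratio_eq_sum:
  assumes F: "0 < fwd_joint q T x0 x" and G: "0 < rev_latent M p prior T x"
    and x: "x \<in> space L" and m: "\<And>t. t \<in> {1..T} \<Longrightarrow> 0 < m t (x t)"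
    and pr: "0 < prior (x T)" and p: "\<And>t. t \<in> {2..T} \<Longrightarrow> 0 < p t (x t) (x (t - 1))"
    and q1: "0 < q 1 x0 (x 1)" and q: "\<And>t. t \<in> {2..T} \<Longrightarrow> 0 < q t (x (t - 1)) (x t)"
  shows "ln (fwd_joint q T x0 x / rev_latent M p prior T x) =
    prior_term x + (\<Sum>t=2..T. step_term t (x t, x (t - 1)))"
proof -
  have lnF: "ln (fwd_joint q T x0 x) =
      ln (q 1 x0 (x 1)) + (\<Sum>t=2..T. ln (q t (x (t - 1)) (x t)))"
    unfolding fwd_joint_split using q1 q by (intro ln_mult_prod) auto
  have lnG: "ln (rev_latent M p prior T x) =
      ln (prior (x T)) + (\<Sum>t=2..T. ln (p t (x t) (x (t - 1))))"
    unfolding rev_latent_eq[OF x[unfolded space_L]] using pr p by (intro ln_mult_prod) auto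
  \<comment> \<open>Bayes' rule in logarithms: the posterior differs from the forward kernel by the
    ratio of the marginals at \<open>t - 1\<close> and \<open>t\<close>.\<close>
  have step: "step_term t (x t, x (t - 1)) =
      ln (q t (x (t - 1)) (x t)) - ln (p t (x t) (x (t - 1)))
      - (ln (m t (x t)) - ln (m (t - 1) (x (t - 1))))" if t: "t \<in> {2..T}" for t
  proof -
    have "0 < m (t - 1) (x (t - 1))" "0 < m t (x t)"
      using t by (auto intro!: m simp del: One_nat_def)
    with p[OF t] q[OF t] show ?thesis
      by (simp add: step_term_def ln_div ln_mult_pos)
  qed
  \<comment> \<open>The corrections by marginals telescope; the end at time 1 cancels the first
    forward kernel and the end at \<open>T\<close> enters the prior term.\<close>
  have "(\<Sum>t=2..T. ln (m t (x t)) - ln (m (t - 1) (x (t - 1)))) = ln (m T (x T)) - ln (m 1 (x 1))"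
    using sum_telescope''[of 1 T "\<lambda>t. ln (m t (x t))"] T by (simp add: numeral_2_eq_2)
  moreover have "m 1 (x 1) = q 1 x0 (x 1)"
    using fwd_marginal_1[OF T] state_in_space[OF x, of 1] T by simp
  moreover have "prior_term x = ln (m T (x T)) - ln (prior (x T))"
    using pr m[of T] T by (simp add: prior_term_def ln_div)
  moreover have "(\<Sum>t=2..T. step_term t (x t, x (t - 1))) =
      (\<Sum>t=2..T. ln (q t (x (t - 1)) (x t))) - (\<Sum>t=2..T. ln (p t (x t) (x (t - 1))))
      - (\<Sum>t=2..T. ln (m t (x t)) - ln (m (t - 1) (x (t - 1))))"
    unfolding sum_subtractf[symmetric] by (rule sum.cong[OF refl step])
  moreover have "ln (fwd_joint q T x0 x / rev_latent M p prior T x) =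
      ln (fwd_joint q T x0 x) - ln (rev_latent M p prior T x)"
    using F G by (rule ln_divide_pos)
  ultimately show ?thesis
    by (simp only: lnF lnG)
qed

text \<open>A positive quotient has nonzero numerator and denominator, so no factor of either
  product vanishes, and nonnegative factors are then positive.\<close>

lemma pos_factors:
  assumes pos: "0 < fwd_joint q T x0 x / rev_latent M p prior T x" and x: "x \<in> space L"
  shows "0 < fwd_joint q T x0 x" "0 < rev_latent M p prior T x" "0 < prior (x T)"
    "0 < q 1 x0 (x 1)"
    "\<And>t. t \<in> {2..T} \<Longrightarrow> 0 < p t (x t) (x (t - 1)) \<and> 0 < q t (x (t - 1)) (x t)"
proof -
  have s: "x t \<in> space M" "x (t - 1) \<in> space M" if "t \<in> {2..T}" for t
    using that by (auto intro!: state_in_space[OF x] simp del: One_nat_def)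
  have s1: "x 1 \<in> space M" "x T \<in> space M"
    using state_in_space[OF x] T by auto
  have F0: "0 \<le> fwd_joint q T x0 x"
    using fwd_joint_nonneg[OF subset_refl order_refl] x by (simp add: space_L)
  have "fwd_joint q T x0 x \<noteq> 0" "rev_latent M p prior T x \<noteq> 0"
    using pos by auto
  then have nz: "prior (x T) \<noteq> 0" "\<And>t. t \<in> {2..T} \<Longrightarrow> p t (x t) (x (t - 1)) \<noteq> 0"
      "q 1 x0 (x 1) \<noteq> 0" "\<And>t. t \<in> {2..T} \<Longrightarrow> q t (x (t - 1)) (x t) \<noteq> 0"
    using x by (auto simp: rev_latent_eq space_L fwd_joint_split)
  show "0 < fwd_joint q T x0 x" "0 < rev_latent M p prior T x"
    using pos F0 by (auto simp: zero_less_divide_iff)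
  show "0 < prior (x T)" "0 < q 1 x0 (x 1)"
    using nz s1 prior_nonneg[of "x T"] q_nonneg[of 1 x0 "x 1"] x0 T by auto
  show "0 < p t (x t) (x (t - 1)) \<and> 0 < q t (x (t - 1)) (x t)" if t: "t \<in> {2..T}" for t
    using nz(2,4)[OF t] s[OF t] p_nonneg[of t "x t" "x (t - 1)"] q_nonneg[of t "x (t - 1)" "x t"] t
    by auto
qed

lemma measurable_rev_latent: "rev_latent M p prior T \<in> borel_measurable (path_measure M {1..T})"
proof -
  have "(\<lambda>x. prior (x T) * (\<Prod>t=2..T. p t (x t) (x (t - 1)))) \<in> borel_measurable (path_measure M {1..T})"
    using T by (intro borel_measurable_times borel_measurable_prod measurable_p_comp
        measurable_compose[OF _ measurable_prior] measurable_component_singleton) auto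
  moreover have "rev_latent M p prior T \<in> borel_measurable (path_measure M {1..T}) \<longleftrightarrow>
      (\<lambda>x. prior (x T) * (\<Prod>t=2..T. p t (x t) (x (t - 1)))) \<in> borel_measurable (path_measure M {1..T})"
    by (rule measurable_cong) (rule rev_latent_eq)
  ultimately show ?thesis
    by blast
qed

lemma KL_fwd_rev:
  assumes "log_expectation_defined L (\<lambda>x. fwd_joint q T x0 x / rev_latent M p prior T x)"
  shows "KL L (rev_latent_law M p prior T) =
    KL (fwd_marginal_law M q T x0 T) (density M (\<lambda>y. ennreal (prior y))) +
    (\<Sum>t=2..T. \<integral>z. KL (density M (\<lambda>y. ennreal (fwd_posterior M q T x0 t z y)))
        (density M (\<lambda>y. ennreal (p t z y))) \<partial>fwd_marginal_law M q T x0 t)"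
proof -
  let ?P = "path_measure M {1..T}"
  note [simp del] = One_nat_def
  let ?F = "fwd_joint q T x0" and ?G = "rev_latent M p prior T"
  interpret P: sigma_finite_measure ?P
    by (rule sigma_finite) simp
  have [measurable]: "?F \<in> borel_measurable ?P" "?G \<in> borel_measurable ?P"
    by (rule measurable_fwd_joint; simp) (rule measurable_rev_latent)
  have F0: "0 \<le> ?F x" if "x \<in> space ?P" for x
    using fwd_joint_nonneg[OF subset_refl order_refl that] .
  have G0: "0 \<le> ?G x" if "x \<in> space ?P" for x
    unfolding rev_latent_eq[OF that] using that T
    by (intro mult_nonneg_nonneg prod_nonneg prior_nonneg p_nonneg)
      (auto simp: space_L[symmetric] intro!: state_in_space)
  have pos: "AE x in L. 0 < ?F x / ?G x" and int: "integrable L (\<lambda>x. ln (?F x / ?G x))"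
    using assms by (auto simp: log_expectation_defined_def)
  \<comment> \<open>The path law has density \<open>?F\<close>, so positivity of the quotient is
    known only where \<open>?F\<close> is positive; there it excludes \<open>?G x = 0\<close>, which
    is absolute continuity.\<close>
  have "AE x in ?P. 0 < ?F x \<longrightarrow> 0 < ?F x / ?G x"
    using pos unfolding fwd_law_def by (subst (asm) AE_density) auto
  with AE_space have ac: "AE x in ?P. ?G x = 0 \<longrightarrow> ?F x = 0"
    by eventually_elim (use F0 in force)
  have "KL L (rev_latent_law M p prior T) = (\<integral>x. ?F x * log (exp 1) (?F x / ?G x) \<partial>?P)"
    unfolding fwd_law_def rev_latent_law_def
    using F0 G0 ac by (intro P.KL_density_density) auto
  also have "\<dots> = (\<integral>x. ln (?F x / ?G x) \<partial>L)"
    unfolding fwd_law_def using F0 by (subst integral_density) (auto simp: log_def)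
  finally have KL_eq: "KL L (rev_latent_law M p prior T) = (\<integral>x. ln (?F x / ?G x) \<partial>L)" .

  \<comment> \<open>Index 1 is free because the steps start at 2; it carries the prior term, so that
    all summands form one family over \<open>{1..T}\<close>.\<close>
  define d where "d t x = (if t = 1 then prior_term x else step_term t (x t, x (t - 1)))"
    for t :: nat and x :: "nat \<Rightarrow> 'a"
  have split: "(\<Sum>t\<in>{1..T}. g t) = g 1 + (\<Sum>t=2..T. g t)" for g :: "nat \<Rightarrow> real"
    using T by (simp add: sum.atLeast_Suc_atMost numeral_2_eq_2)
  have cases: "t = 1 \<or> t \<noteq> 1 \<and> t \<in> {2..T}" if "t \<in> {1..T}" for t
    using that by auto
  have d_meas: "d t \<in> borel_measurable L" if "t \<in> {1..T}" for t
    using cases[OF that] measurable_prior_term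
      measurable_compose[OF measurable_state_pair measurable_step_term]
    by (auto simp: d_def[abs_def])
  have d_neg: "integrable L (\<lambda>x. max 0 (- d t x))" if "t \<in> {1..T}" for t
    using cases[OF that] integrable_prior_term_neg integrable_step_term_neg
    by (auto simp: d_def)
  have "AE x in L. \<forall>t\<in>{1..T}. 0 < m t (x t)"
    by (intro AE_finite_allI AE_fwd_marginal_pos) auto
  with AE_space pos have sum_eq: "AE x in L. ln (?F x / ?G x) = (\<Sum>t\<in>{1..T}. d t x)"
  proof eventually_elim
    case (elim x)
    have "ln (?F x / ?G x) = prior_term x + (\<Sum>t=2..T. step_term t (x t, x (t - 1)))"
      using elim(3) pos_factors[OF elim(2,1)] by (intro ln_ratio_eq_sum elim(1)) auto
    also have "\<dots> = (\<Sum>t\<in>{1..T}. d t x)"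
      unfolding split by (auto simp: d_def intro!: sum.cong)
    finally show ?case .
  qed
  have sum_meas: "(\<lambda>x. \<Sum>t\<in>{1..T}. d t x) \<in> borel_measurable L"
    using d_meas by auto
  have "integrable L (\<lambda>x. \<Sum>t\<in>{1..T}. d t x)"
    using integrable_cong_AE[OF borel_measurable_integrable[OF int] sum_meas sum_eq] int by simp
  \<comment> \<open>Integrability of each summand justifies exchanging expectation and sum, and is
    the integrability hypothesis of \<open>expectation_KL_posterior\<close>.\<close>
  then have d_int: "integrable L (d t)" if "t \<in> {1..T}" for t
    using that d_meas d_neg by (intro integrable_summand_of_neg_parts[of "{1..T}" t d]) auto

  have "AE x in L. 0 < prior (x T)"
    using AE_space pos by eventually_elim (rule pos_factors)
  then have K1: "KL (fwd_marginal_law M q T x0 T) (density M (\<lambda>y. ennreal (prior y))) =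
      (\<integral>x. d 1 x \<partial>L)"
    by (simp add: KL_prior d_def)
  have Kt: "(\<integral>z. KL (density M (\<lambda>y. ennreal (fwd_posterior M q T x0 t z y)))
        (density M (\<lambda>y. ennreal (p t z y))) \<partial>fwd_marginal_law M q T x0 t) = (\<integral>x. d t x \<partial>L)"
    if t: "t \<in> {2..T}" for t
  proof -
    have dt: "d t = (\<lambda>x. step_term t (x t, x (t - 1)))"
      using t by (auto simp: d_def)
    have "AE x in L. 0 < p t (x t) (x (t - 1))"
      using AE_space pos by eventually_elim (use pos_factors(5) t in blast)
    then show ?thesis
      using d_int[of t] t unfolding dt by (intro expectation_KL_posterior) auto
  qed
  have "KL L (rev_latent_law M p prior T) = (\<integral>x. (\<Sum>t\<in>{1..T}. d t x) \<partial>L)"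
    unfolding KL_eq using borel_measurable_integrable[OF int] sum_meas sum_eq
    by (rule integral_cong_AE)
  also have "\<dots> = (\<Sum>t\<in>{1..T}. \<integral>x. d t x \<partial>L)"
    using d_int by (intro Bochner_Integration.integral_sum)
  finally show ?thesis
    unfolding split by (simp add: K1 Kt)
qed

end

section \<open>Specialization to Lebesgue and counting measure\<close>

lemma diffusion_of_model:
  assumes "sigma_finite_measure M" "diffusion_model M T q p prior" "x0 \<in> space M" "1 \<le> T"
  shows "diffusion M q T x0 p prior"
  using assms
  by (auto simp: diffusion_def diffusion_axioms_def forward_process_def forward_process_axioms_def
      diffusion_model_def)

theorem mainTheorem9:
  fixes T :: nat
  assumes "1 \<le> T"
  shows "(let M = (lborel :: (real ^ 'd) measure) in
          \<forall>q p prior x0. diffusion_model M T q p prior \<longrightarrow>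
            (log_expectation_defined (fwd_law M q T x0) (rev_cond M p prior T x0) \<longrightarrow>
               (\<integral>x. ln (rev_cond M p prior T x0 x) \<partial>fwd_law M q T x0) =
               (\<integral>y. ln (p 1 y x0) \<partial>fwd_marginal_law M q T x0 1)) \<and>
            (log_expectation_defined (fwd_law M q T x0)
                (\<lambda>x. fwd_joint q T x0 x / rev_latent M p prior T x) \<longrightarrow>
               KL (fwd_law M q T x0) (rev_latent_law M p prior T) =
               KL (fwd_marginal_law M q T x0 T) (density M (\<lambda>y. ennreal (prior y))) +
               (\<Sum>t=2..T. \<integral>z. KL (density M (\<lambda>y. ennreal (fwd_posterior M q T x0 t z y)))
                                    (density M (\<lambda>y. ennreal (p t z y)))
                          \<partial>fwd_marginal_law M q T x0 t))) \<and>
         (let M = (count_space UNIV :: (('k::finite) ^ 'd) measure) in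
          \<forall>q p prior x0. diffusion_model M T q p prior \<longrightarrow>
            (log_expectation_defined (fwd_law M q T x0) (rev_cond M p prior T x0) \<longrightarrow>
               (\<integral>x. ln (rev_cond M p prior T x0 x) \<partial>fwd_law M q T x0) =
               (\<integral>y. ln (p 1 y x0) \<partial>fwd_marginal_law M q T x0 1)) \<and>
            (log_expectation_defined (fwd_law M q T x0)
                (\<lambda>x. fwd_joint q T x0 x / rev_latent M p prior T x) \<longrightarrow>
               KL (fwd_law M q T x0) (rev_latent_law M p prior T) =
               KL (fwd_marginal_law M q T x0 T) (density M (\<lambda>y. ennreal (prior y))) +
               (\<Sum>t=2..T. \<integral>z. KL (density M (\<lambda>y. ennreal (fwd_posterior M q T x0 t z y)))
                                    (density M (\<lambda>y. ennreal (p t z y)))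
                          \<partial>fwd_marginal_law M q T x0 t)))"
proof -
  \<comment> \<open>Both reference measures are sigma-finite and have the whole type as space, so
    every \<open>x0\<close> is an admissible starting point.\<close>
  have 1: "diffusion (lborel :: (real ^ 'd) measure) q T x0 p prior"
    if "diffusion_model lborel T q p prior" for q p prior x0
    using that assms by (intro diffusion_of_model) (auto intro: lborel.sigma_finite_measure_axioms)
  have 2: "diffusion (count_space UNIV :: ('k ^ 'd) measure) q T x0 p prior"
    if "diffusion_model (count_space UNIV) T q p prior" for q p prior x0
    using that assms
    by (intro diffusion_of_model) (auto intro: sigma_finite_measure_count_space_finite)
  show ?thesis
    unfolding Let_def
    by (intro conjI allI impI diffusion.expectation_ln_rev_cond diffusion.KL_fwd_rev 1 2)
qed

end
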